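(* Let $\mathbb{K}$ be a field of characteristic $0$, $R=\mathbb{K}[x_1,\dots,x_n]$, and let $I\subseteq R$ be an unmixed ideal with minimal primary decomposition $I=q_1\cap\dots\cap q_r$. For $i=1,\dots,r$ let $N_i$ be a set of Noetherian operators for $q_i$. For each $D\in\bigcup_i N_i$, choose $h_D\in\bigcap_{j:\,D\notin N_j}\sqrt{q_j}\setminus\bigcup_{i:\,D\in N_i}\sqrt{q_i}$. Then $N:=\{h_DD: D\in\bigcup_iN_i\}$ is a set of Noetherian operators for $I$.
   Context: $W_R=R\langle\partial_1,\dots,\partial_n\rangle$ is the Weyl algebra ($\partial_i=\partial/\partial x_i$) acting on $R$, written $D\bullet f$. A set $N\subseteq W_R$ is a set of Noetherian operators for an ideal $J$ if for all $f\in R$: $f\in J\iff D\bullet f\in\sqrt J$ for all $D\in N$. An ideal is unmixed if all its associated primes have the same dimension (in particular it has no embedded primes). An empty intersection of ideals is $R$. *)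

theory Defs
  imports Main "HOL-Library.Poly_Mapping" "HOL-Library.Extended_Nat"
begin

text \<open>Polynomial ring R = K[x_i : i in 'n] over a field K, where the finite type 'n
  indexes the n variables (n = CARD('n)).\<close>

type_synonym ('n, 'a) mpoly = "('n \<Rightarrow>\<^sub>0 nat) \<Rightarrow>\<^sub>0 'a"

text \<open>Elements of the Weyl algebra W_R, in normal form sum_alpha r_alpha d^alpha:
  a finitely supported map from multi-indices alpha to coefficients r_alpha in R.\<close>

type_synonym ('n, 'a) weyl = "('n \<Rightarrow>\<^sub>0 nat) \<Rightarrow>\<^sub>0 ('n, 'a) mpoly"

definition pdiff :: "('n::finite \<Rightarrow>\<^sub>0 nat) \<Rightarrow> ('n, 'a::field) mpoly \<Rightarrow> ('n, 'a) mpoly" where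
  "pdiff \<alpha> f = (\<Sum>\<beta>\<in>Poly_Mapping.keys f.
      Poly_Mapping.single (\<beta> - \<alpha>)
        ((\<Prod>i\<in>UNIV. \<Prod>k<Poly_Mapping.lookup \<alpha> i. (of_nat (Poly_Mapping.lookup \<beta> i - k) :: 'a)) * Poly_Mapping.lookup f \<beta>))"

definition weyl_act :: "('n::finite, 'a::field) weyl \<Rightarrow> ('n, 'a) mpoly \<Rightarrow> ('n, 'a) mpoly" where
  "weyl_act D f = (\<Sum>\<alpha>\<in>Poly_Mapping.keys D. Poly_Mapping.lookup D \<alpha> * pdiff \<alpha> f)"

definition weyl_lmult :: "('n::finite, 'a::field) mpoly \<Rightarrow> ('n, 'a) weyl \<Rightarrow> ('n, 'a) weyl" where
  "weyl_lmult h D = Poly_Mapping.map (\<lambda>c. h * c) D"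

definition is_ideal :: "'r::comm_ring_1 set \<Rightarrow> bool" where
  "is_ideal I \<longleftrightarrow> 0 \<in> I \<and> (\<forall>a\<in>I. \<forall>b\<in>I. a + b \<in> I) \<and> (\<forall>r. \<forall>a\<in>I. r * a \<in> I)"

definition radical :: "'r::comm_ring_1 set \<Rightarrow> 'r set" where
  "radical I = {f. \<exists>k. f ^ k \<in> I}"

definition prime_ideal :: "'r::comm_ring_1 set \<Rightarrow> bool" where
  "prime_ideal P \<longleftrightarrow> is_ideal P \<and> P \<noteq> UNIV \<and> (\<forall>a b. a * b \<in> P \<longrightarrow> a \<in> P \<or> b \<in> P)"

definition primary_ideal :: "'r::comm_ring_1 set \<Rightarrow> bool" where
  "primary_ideal Q \<longleftrightarrow> is_ideal Q \<and> Q \<noteq> UNIV \<and>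
     (\<forall>a b. a * b \<in> Q \<longrightarrow> a \<in> Q \<or> b \<in> radical Q)"

definition ass_primes :: "'r::comm_ring_1 set \<Rightarrow> 'r set set" where
  "ass_primes I = {P. prime_ideal P \<and> (\<exists>f. P = {g. g * f \<in> I})}"

text \<open>Dimension of a prime P = Krull dimension of R/P: supremum of the lengths k of
  strictly increasing chains of primes P = P_0 < P_1 < ... < P_k.\<close>

definition prime_dim :: "'r::comm_ring_1 set \<Rightarrow> enat" where
  "prime_dim P = (SUP k \<in> {k::nat. \<exists>c::nat \<Rightarrow> 'r set. c 0 = P \<and>
        (\<forall>i\<le>k. prime_ideal (c i)) \<and> (\<forall>i<k. c i \<subset> c (Suc i))}. enat k)"

definition unmixed :: "'r::comm_ring_1 set \<Rightarrow> bool" where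
  "unmixed I \<longleftrightarrow> (\<forall>P\<in>ass_primes I. \<forall>Q\<in>ass_primes I. prime_dim P = prime_dim Q)"

definition minimal_primary_decomposition :: "'r::comm_ring_1 set \<Rightarrow> nat \<Rightarrow> (nat \<Rightarrow> 'r set) \<Rightarrow> bool" where
  "minimal_primary_decomposition I r q \<longleftrightarrow>
     I = (\<Inter>i<r. q i) \<and> (\<forall>i<r. primary_ideal (q i)) \<and>
     (\<forall>i<r. \<forall>j<r. i \<noteq> j \<longrightarrow> radical (q i) \<noteq> radical (q j)) \<and>
     (\<forall>i<r. (\<Inter>j\<in>{j. j < r \<and> j \<noteq> i}. q j) \<noteq> I)"

definition noetherian_operators :: "('n::finite, 'a::field) weyl set \<Rightarrow> ('n, 'a) mpoly set \<Rightarrow> bool" where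
  "noetherian_operators N J \<longleftrightarrow> (\<forall>f. f \<in> J \<longleftrightarrow> (\<forall>D\<in>N. weyl_act D f \<in> radical J))"

end

theory Submission
  imports Defs
begin

text \<open>Membership in \<open>q\<^sub>j\<close> is tested by the operators of \<open>N\<^sub>j\<close>, and modulo \<open>\<surd>q\<^sub>j\<close> the rescaled
  operator \<open>h\<^sub>D D\<close> acts like \<open>D\<close> if \<open>D \<in> N\<^sub>j\<close> (since \<open>h\<^sub>D \<notin> \<surd>q\<^sub>j\<close> and \<open>\<surd>q\<^sub>j\<close> is prime) and like
  \<open>0\<close> otherwise (since \<open>h\<^sub>D \<in> \<surd>q\<^sub>j\<close>). As the radical of a finite intersection is the intersection
  of the radicals, the rescaled operators together test membership in \<open>I = \<Inter>\<^sub>j q\<^sub>j\<close>.\<close>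

lemma ideal_mult_left: "is_ideal Q \<Longrightarrow> a \<in> Q \<Longrightarrow> r * a \<in> Q"
  unfolding is_ideal_def by blast

lemma primary_ideal_imp_ideal: "primary_ideal Q \<Longrightarrow> is_ideal Q"
  unfolding primary_ideal_def by blast

lemma ideal_power_mono:
  assumes "is_ideal Q" "f ^ k \<in> Q" "k \<le> m"
  shows "f ^ m \<in> Q"
proof -
  have "f ^ m = f ^ (m - k) * f ^ k"
    using assms(3) by (simp flip: power_add)
  then show ?thesis
    using ideal_mult_left[OF assms(1,2)] by simp
qed

lemma radical_mult_left:
  assumes "is_ideal Q" "b \<in> radical Q"
  shows "a * b \<in> radical Q"
proof -
  obtain k where "b ^ k \<in> Q"
    using assms(2) by (auto simp: radical_def)
  then have "(a * b) ^ k \<in> Q"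
    using ideal_mult_left[OF assms(1)] by (simp add: power_mult_distrib)
  then show ?thesis
    by (auto simp: radical_def)
qed

lemma radical_primary_mult_cancel_left:
  assumes "primary_ideal Q" "a \<notin> radical Q"
  shows "a * b \<in> radical Q \<longleftrightarrow> b \<in> radical Q"
proof
  assume "a * b \<in> radical Q"
  then obtain k where "a ^ k * b ^ k \<in> Q"
    by (auto simp: radical_def power_mult_distrib)
  moreover have "a ^ k \<notin> radical Q"
    using assms(2) by (auto simp: radical_def simp flip: power_mult)
  ultimately have "b ^ k \<in> Q"
    using assms(1) unfolding primary_ideal_def by (metis mult.commute)
  then show "b \<in> radical Q"
    by (auto simp: radical_def)
next
  assume "b \<in> radical Q"
  then show "a * b \<in> radical Q"
    using radical_mult_left primary_ideal_imp_ideal assms(1) by blast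
qed

lemma radical_INT:
  assumes "finite A" "\<And>i. i \<in> A \<Longrightarrow> is_ideal (q i)"
  shows "radical (\<Inter>i\<in>A. q i) = (\<Inter>i\<in>A. radical (q i))"
proof
  show "radical (\<Inter>i\<in>A. q i) \<subseteq> (\<Inter>i\<in>A. radical (q i))"
    by (auto simp: radical_def)
next
  show "(\<Inter>i\<in>A. radical (q i)) \<subseteq> radical (\<Inter>i\<in>A. q i)"
  proof
    fix f
    assume "f \<in> (\<Inter>i\<in>A. radical (q i))"
    then obtain k where k: "\<And>i. i \<in> A \<Longrightarrow> f ^ k i \<in> q i"
      unfolding radical_def by simp metis
    have "f ^ (\<Sum>i\<in>A. k i) \<in> q i" if "i \<in> A" for i
      using ideal_power_mono[OF assms(2) k] member_le_sum[of i A k] assms(1) that by blast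
    then show "f \<in> radical (\<Inter>i\<in>A. q i)"
      by (auto simp: radical_def)
  qed
qed

lemma weyl_act_lmult: "weyl_act (weyl_lmult h D) f = h * weyl_act D f"
proof -
  have lookup_lmult: "Poly_Mapping.lookup (weyl_lmult h D) \<alpha> = h * Poly_Mapping.lookup D \<alpha>" for \<alpha>
    unfolding weyl_lmult_def by (simp add: Poly_Mapping.map.rep_eq when_def)
  then have "Poly_Mapping.keys (weyl_lmult h D) \<subseteq> Poly_Mapping.keys D"
    by (auto simp: in_keys_iff)
  then have "weyl_act (weyl_lmult h D) f =
      (\<Sum>\<alpha>\<in>Poly_Mapping.keys D. Poly_Mapping.lookup (weyl_lmult h D) \<alpha> * pdiff \<alpha> f)"
    unfolding weyl_act_def by (intro sum.mono_neutral_left) (auto simp: in_keys_iff)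
  also have "\<dots> = h * weyl_act D f"
    unfolding weyl_act_def lookup_lmult by (simp add: sum_distrib_left mult.assoc)
  finally show ?thesis .
qed

lemma noetherian_operators_INT_lmult:
  fixes q :: "nat \<Rightarrow> ('n::finite, 'a::field) mpoly set"
  assumes primary: "\<And>j. j < r \<Longrightarrow> primary_ideal (q j)"
    and operators: "\<And>j. j < r \<Longrightarrow> noetherian_operators (N j) (q j)"
    and h_in: "\<And>D j. D \<in> (\<Union>i<r. N i) \<Longrightarrow> j < r \<Longrightarrow> D \<notin> N j \<Longrightarrow> h D \<in> radical (q j)"
    and h_notin: "\<And>D j. D \<in> (\<Union>i<r. N i) \<Longrightarrow> j < r \<Longrightarrow> D \<in> N j \<Longrightarrow> h D \<notin> radical (q j)"
  shows "noetherian_operators {weyl_lmult (h D) D | D. D \<in> (\<Union>i<r. N i)} (\<Inter>j<r. q j)"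
proof -
  have ideal: "\<And>j. j < r \<Longrightarrow> is_ideal (q j)"
    using primary primary_ideal_imp_ideal by blast
  have rescaled_iff: "h D * weyl_act D f \<in> radical (q j) \<longleftrightarrow>
      (D \<in> N j \<longrightarrow> weyl_act D f \<in> radical (q j))"
    if "D \<in> (\<Union>i<r. N i)" "j < r" for D f j
  proof (cases "D \<in> N j")
    case True
    then show ?thesis
      using radical_primary_mult_cancel_left[OF primary h_notin] that by blast
  next
    case False
    then show ?thesis
      using radical_mult_left[OF ideal h_in, of j D] that by (metis mult.commute)
  qed
  have radical_Inter: "radical (\<Inter>j<r. q j) = (\<Inter>j<r. radical (q j))"
    using radical_INT[of "{..<r}" q] ideal by simp
  show ?thesis
    unfolding noetherian_operators_def
  proof
    fix f
    have "f \<in> (\<Inter>j<r. q j) \<longleftrightarrow> (\<forall>j<r. \<forall>D\<in>N j. weyl_act D f \<in> radical (q j))"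
      using operators unfolding noetherian_operators_def by blast
    also have "\<dots> \<longleftrightarrow> (\<forall>D\<in>(\<Union>i<r. N i). \<forall>j<r. h D * weyl_act D f \<in> radical (q j))"
      using rescaled_iff by blast
    also have "\<dots> \<longleftrightarrow> (\<forall>D\<in>{weyl_lmult (h D) D | D. D \<in> (\<Union>i<r. N i)}.
        weyl_act D f \<in> radical (\<Inter>j<r. q j))"
      unfolding radical_Inter by (fastforce simp: weyl_act_lmult)
    finally show "f \<in> (\<Inter>j<r. q j) \<longleftrightarrow> (\<forall>D\<in>{weyl_lmult (h D) D | D. D \<in> (\<Union>i<r. N i)}.
        weyl_act D f \<in> radical (\<Inter>j<r. q j))" .
  qed
qed

theorem proposition5p2:
  fixes I :: "('n::finite, 'a::field_char_0) mpoly set"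
    and r :: nat
    and q :: "nat \<Rightarrow> ('n, 'a) mpoly set"
    and N :: "nat \<Rightarrow> ('n, 'a) weyl set"
    and h :: "('n, 'a) weyl \<Rightarrow> ('n, 'a) mpoly"
  assumes "unmixed I"
    and "minimal_primary_decomposition I r q"
    and "\<forall>i<r. noetherian_operators (N i) (q i)"
    and "\<forall>D\<in>(\<Union>i<r. N i).
           h D \<in> (\<Inter>j\<in>{j. j < r \<and> D \<notin> N j}. radical (q j))
                  - (\<Union>i\<in>{i. i < r \<and> D \<in> N i}. radical (q i))"
  shows "noetherian_operators {weyl_lmult (h D) D | D. D \<in> (\<Union>i<r. N i)} I"
proof -
  have "I = (\<Inter>j<r. q j)" and "\<And>j. j < r \<Longrightarrow> primary_ideal (q j)"
    using assms(2) unfolding minimal_primary_decomposition_def by auto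
  with assms(3,4) show ?thesis
    using noetherian_operators_INT_lmult[of r q N h] by blast
qed

end
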